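(* Let $l \le m_l \le m_r \le r$ be real numbers, let $c\in[0,1]$, and let $t\ge 1$ be an integer. Let $A=(l,m_l,m_r,r)$ be the discrete leveled trapezoidal fuzzy number with equally spaced levels $\alpha_i=\frac{i}{t}$, $i=0,1,\dots,t$, and let the level weights be equally distributed, i.e. $p_i=\frac{1}{t+1}$ for $i=0,1,\dots,t$. Then $$WABL(A)=\frac{M(0)+M(1)}{2}.$$
   Context: A trapezoidal fuzzy number $A=(l,m_l,m_r,r)$ with $l\le m_l\le m_r\le r$ real is described by its level sets $A_\alpha=[L(\alpha),R(\alpha)]$, where for $\alpha\in[0,1]$ $$L(\alpha)=l+\alpha(m_l-l),\qquad R(\alpha)=r-\alpha(r-m_r).$$ It is called a discrete leveled trapezoidal fuzzy number when only the level sets at finitely many levels $\alpha_0<\alpha_1<\dots<\alpha_t$ in $[0,1]$ are considered. Equally spaced levels ($\Delta\alpha=\text{const}$) means $\Delta\alpha=\frac1t$ and $\alpha_i=i\,\Delta\alpha=\frac{i}{t}$, $i=0,\dots,t$. For a fixed "optimism" coefficient $c\in[0,1]$, put $$M(\alpha)=(1-c)L(\alpha)+cR(\alpha),\qquad \alpha\in[0,1].$$ Given level weights $p_i\ge 0$, $i=0,\dots,t$, with $\sum_{i=0}^t p_i=1$, the Weighted Average Based on Levels (WABL) value of $A$ is $$WABL(A)=\sum_{i=0}^{t}p_i\,M(\alpha_i).$$ *)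

theory Defs
  imports Complex_Main
begin

text \<open>The trapezoidal fuzzy number (l, m_l, m_r, r). The datatype does not enforce
  l \<le> m_l \<le> m_r \<le> r; this is the predicate \<open>valid_trapezoid\<close>.\<close>

datatype trapezoid =
  Trapezoid (left_end: real) (left_mode: real) (right_mode: real) (right_end: real)

definition valid_trapezoid :: "trapezoid \<Rightarrow> bool" where
  "valid_trapezoid A \<longleftrightarrow>
     left_end A \<le> left_mode A \<and> left_mode A \<le> right_mode A \<and> right_mode A \<le> right_end A"

definition L :: "trapezoid \<Rightarrow> real \<Rightarrow> real" where
  "L A \<alpha> = left_end A + \<alpha> * (left_mode A - left_end A)"

definition R :: "trapezoid \<Rightarrow> real \<Rightarrow> real" where
  "R A \<alpha> = right_end A - \<alpha> * (right_end A - right_mode A)"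

definition level_set :: "trapezoid \<Rightarrow> real \<Rightarrow> real set" where
  "level_set A \<alpha> = {L A \<alpha>..R A \<alpha>}"

definition M :: "real \<Rightarrow> trapezoid \<Rightarrow> real \<Rightarrow> real" where
  "M c A \<alpha> = (1 - c) * L A \<alpha> + c * R A \<alpha>"

text \<open>The discrete leveled number is the trapezoid \<open>A\<close> together with the levels
  \<open>\<alpha> 0, \<dots>, \<alpha> t\<close>; its level weights are \<open>p 0, \<dots>, p t\<close>. Values of \<open>\<alpha>\<close> and \<open>p\<close> at
  indices above \<open>t\<close> are irrelevant.\<close>

definition WABL :: "real \<Rightarrow> nat \<Rightarrow> (nat \<Rightarrow> real) \<Rightarrow> (nat \<Rightarrow> real) \<Rightarrow> trapezoid \<Rightarrow> real" where
  "WABL c t \<alpha> p A = (\<Sum>i=0..t. p i * M c A (\<alpha> i))"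

definition discrete_levels :: "nat \<Rightarrow> (nat \<Rightarrow> real) \<Rightarrow> bool" where
  "discrete_levels t \<alpha> \<longleftrightarrow> strict_mono_on {0..t} \<alpha> \<and> \<alpha> ` {0..t} \<subseteq> {0..1}"

definition level_weights :: "nat \<Rightarrow> (nat \<Rightarrow> real) \<Rightarrow> bool" where
  "level_weights t p \<longleftrightarrow> (\<forall>i\<in>{0..t}. 0 \<le> p i) \<and> (\<Sum>i=0..t. p i) = 1"

definition equally_spaced :: "nat \<Rightarrow> (nat \<Rightarrow> real) \<Rightarrow> bool" where
  "equally_spaced t \<alpha> \<longleftrightarrow> (\<forall>i\<in>{0..t}. \<alpha> i = real i / real t)"

definition equally_distributed :: "nat \<Rightarrow> (nat \<Rightarrow> real) \<Rightarrow> bool" where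
  "equally_distributed t p \<longleftrightarrow> (\<forall>i\<in>{0..t}. p i = 1 / (real t + 1))"

text \<open>The general requirements on levels and weights are consequences of the special
  choices, so they need not be assumed separately.\<close>

lemma equally_spaced_discrete_levels:
  assumes "t \<ge> 1" and "equally_spaced t \<alpha>"
  shows "discrete_levels t \<alpha>"
  using assms
  by (auto simp: discrete_levels_def equally_spaced_def strict_mono_on_def divide_strict_right_mono)

lemma equally_distributed_level_weights:
  assumes "equally_distributed t p"
  shows "level_weights t p"
  using assms by (auto simp: level_weights_def equally_distributed_def)

lemma level_set_nonempty:
  assumes "valid_trapezoid A" and "0 \<le> \<alpha>" and "\<alpha> \<le> 1"
  shows "level_set A \<alpha> \<noteq> {}"
proof -
  have "\<alpha> * (left_mode A - left_end A) \<le> left_mode A - left_end A"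
    using assms by (intro mult_left_le_one_le) (auto simp: valid_trapezoid_def)
  moreover have "\<alpha> * (right_end A - right_mode A) \<le> right_end A - right_mode A"
    using assms by (intro mult_left_le_one_le) (auto simp: valid_trapezoid_def)
  ultimately show ?thesis
    using assms(1) by (auto simp: level_set_def L_def R_def valid_trapezoid_def)
qed

end

theory Submission
  imports Defs
begin

text \<open>Both endpoints of a level set are affine in the level, hence so is \<open>M c A\<close>
  (\<open>M_affine\<close>). An equally weighted average of an affine function is its value at the
  mean argument, and the levels i/t have mean 1/2 (\<open>sum_equally_spaced_levels\<close>); there
  \<open>M c A\<close> takes the midpoint of its values at 0 and 1.\<close>

lemma M_affine: "M c A \<alpha> = M c A 0 + \<alpha> * (M c A 1 - M c A 0)"
  by (simp add: M_def L_def R_def algebra_simps)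

text \<open>Gauss's formula sums the numerators to t(t + 1)/2; \<open>t \<ge> 1\<close> lets the
  factor t cancel.\<close>

lemma sum_equally_spaced_levels:
  assumes "t \<ge> 1"
  shows "(\<Sum>i=0..t. real i / real t) = (real t + 1) / 2"
proof -
  have "2 * (\<Sum>i=0..t. real i) = real t * (real t + 1)"
    by (rule double_gauss_sum)
  with assms show ?thesis
    by (simp add: sum_divide_distrib[symmetric] field_simps)
qed

theorem theorem5p1:
  fixes l m_l m_r r c :: real and t :: nat and \<alpha> p :: "nat \<Rightarrow> real" and A :: trapezoid
  assumes "A = Trapezoid l m_l m_r r"
    and "valid_trapezoid A"
    and "0 \<le> c" and "c \<le> 1"
    and "t \<ge> 1"
    and "equally_spaced t \<alpha>"
    and "equally_distributed t p"
  shows "WABL c t \<alpha> p A = (M c A 0 + M c A 1) / 2"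
proof -
  let ?d = "M c A 1 - M c A 0"
  have "WABL c t \<alpha> p A = (\<Sum>i=0..t. 1 / (real t + 1) * (M c A 0 + real i / real t * ?d))"
    unfolding WABL_def
  proof (rule sum.cong)
    fix i assume "i \<in> {0..t}"
    then have "p i = 1 / (real t + 1)" "\<alpha> i = real i / real t"
      using assms(6,7) by (auto simp: equally_spaced_def equally_distributed_def)
    then show "p i * M c A (\<alpha> i) = 1 / (real t + 1) * (M c A 0 + real i / real t * ?d)"
      \<comment> \<open>A fixed instance is used because \<open>M_affine\<close> as a rewrite rule
        would loop: its right side again contains values of \<open>M\<close>.\<close>
      using M_affine[of c A "\<alpha> i"] by simp
  qed simp
  also have "\<dots> = 1 / (real t + 1) * (\<Sum>i=0..t. M c A 0 + real i / real t * ?d)"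
    by (rule sum_distrib_left[symmetric])
  also have "(\<Sum>i=0..t. M c A 0 + real i / real t * ?d)
      = (real t + 1) * M c A 0 + (\<Sum>i=0..t. real i / real t) * ?d"
    unfolding sum.distrib sum_distrib_right by simp
  \<comment> \<open>Adding half of \<open>?d\<close> to \<open>M c A 0\<close> gives the midpoint;
    the factor t + 1 left over cancels the common weight.\<close>
  also have "\<dots> = (real t + 1) * ((M c A 0 + M c A 1) / 2)"
    unfolding sum_equally_spaced_levels[OF \<open>t \<ge> 1\<close>] by (simp add: field_simps)
  finally show ?thesis
    by simp
qed

end
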